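(* Let $g:\mathbb{R}\to\mathbb{R}$ be a derivator with $\infty\notin N_g^+$, $\mathbb{F}\in\{\mathbb{R},\mathbb{C}\}$, $\lambda\in\mathbb{F}\setminus\{0\}$ and $x_0\in\mathbb{R}$. If $1+\lambda\Delta g(x)\neq 0$ for all $x<x_0$, then $\operatorname{Exp}_g(\lambda;x_0)$ is a Stieltjes-analytic solution, defined on the whole real line, of the problem $$v'_g(x)=\lambda v(x),\quad x\in\mathbb{R},\qquad v(x_0)=1.$$
   Context: A derivator is a left-continuous non-decreasing function $g:\mathbb{R}\to\mathbb{R}$. $\mu_g$ denotes its Lebesgue–Stieltjes measure, characterized on Borel sets by $\mu_g([a,b))=g(b)-g(a)$ for $a<b$. $g$-monomials centered at $t\in\mathbb{R}$: $g_{t,0}\equiv 1$ and, for $n\ge 1$, $g_{t,n}(x)=n\int_{[t,x)}g_{t,n-1}\,d\mu_g$ if $x\ge t$ and $g_{t,n}(x)=-n\int_{[x,t)}g_{t,n-1}\,d\mu_g$ if $x<t$. Exponential series: $\exp_g(\lambda;t)(x)=\sum_{n=0}^\infty\lambda^n\frac{g_{t,n}(x)}{n!}$ at those points $x$ where the sum converges absolutely (this includes all $x\ge t$). Under the hypothesis $1+\lambda\Delta g(x)\ne0$ for all $x<x_0$, define $\operatorname{Exp}_g(\lambda;x_0):\mathbb{R}\to\mathbb{F}$ by $\operatorname{Exp}_g(\lambda;x_0)(x)=\frac{\exp_g(\lambda;t)(x)}{\exp_g(\lambda;t)(x_0)}$ for any $t<\min\{x,x_0\}$ (the denominator is nonzero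 and the value does not depend on $t$). Stieltjes-analytic: for $\Omega\subset\mathbb{R}$ open in the usual topology, $f:\Omega\to\mathbb{F}$ is Stieltjes-analytic on $\Omega$ if for all $y\in\Omega$ there exist $\delta>0$ and $t\in\mathbb{R}$ with $y\in(t,t+\delta)\subset\Omega$, and a sequence $\{a_n\}_{n=0}^\infty\subset\mathbb{F}$, such that $f(x)=\sum_{n=0}^\infty a_n g_{t,n}(x)$ for all $x\in(t,t+\delta)$, the sum converging absolutely. Put $\Delta g(x)=g(x^+)-g(x)$, $D_g=\{x:\Delta g(x)>0\}$, $C_g=\{x: g$ is constant on $(x-\varepsilon,x+\varepsilon)$ for some $\varepsilon>0\}$. Write the open set $C_g$ as the disjoint union of its connected components $(a_n,b_n)$, $n\in\Lambda\subset\mathbb N$ (with $a_n,b_n\in\mathbb{R}\cup\{\pm\infty\}$). Set $N_g^-=\{a_n\}_{n\in\Lambda}\setminus D_g$, $N_g^+=\{b_n\}_{n\in\Lambda}\setminus D_g$. The assumption $\infty\notin N_g^+$ means no component of $C_g$ is unbounded above. $g$-derivative of $f:\mathbb{R}\to\mathbb{F}$ at $x$ (when the limit exists): $f'_g(x)=\lim_{y\to x^+}\frac{f(y)-f(x)}{g(y)-g(x)}$ if $x\in D_g$; $f'_g(x)=\lim_{y\to x}\frac{f(y)-f(x)}{g(y)-g(x)}$ if $x\notin D_g\cup C_g$, where the limit is taken only from the right if $x\in N_g^+$ and only from the left if $x\in N_g^-$; $f'_g(x)=\lim_{y\to b_n^+}\frac{f(y)-f(b_n)}{g(y)-g(b_n)}$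 if $x\in(a_n,b_n)$, a component of $C_g$. *)

theory Defs
  imports "HOL-Analysis.Analysis"
begin

definition derivator :: "(real \<Rightarrow> real) \<Rightarrow> bool" where
  "derivator g \<longleftrightarrow> mono g \<and> (\<forall>x. continuous (at_left x) g)"

(* The library's interval_measure F is the Stieltjes measure of a right-continuous F, with
   mass F b - F a on {a<..b}.  For left-continuous g the function x \<mapsto> - g (- x) is
   right-continuous, and reflecting its measure at 0 gives mass g b - g a to {a..<b}. *)
definition stieltjes_measure :: "(real \<Rightarrow> real) \<Rightarrow> real measure" where
  "stieltjes_measure g = distr (interval_measure (\<lambda>x. - g (- x))) borel uminus"

lemma sets_stieltjes_measure [simp, measurable_cong]:
  "sets (stieltjes_measure g) = sets borel"
  by (simp add: stieltjes_measure_def)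

lemma emeasure_stieltjes_measure_Ico:
  assumes g: "derivator g" and ab: "a \<le> b"
  shows "emeasure (stieltjes_measure g) {a..<b} = g b - g a"
proof -
  have cont: "continuous (at_right x) (\<lambda>x. - g (- x))" for x
  proof -
    have "(g \<longlongrightarrow> g (- x)) (at_left (- x))"
      using g by (simp add: derivator_def continuous_within)
    then have "((\<lambda>y. g (- y)) \<longlongrightarrow> g (- x)) (at_right x)"
      by (simp add: at_left_minus filterlim_filtermap)
    then show ?thesis
      by (auto simp: continuous_within intro: tendsto_minus)
  qed
  have "uminus -` {a..<b} = {- b<..- a}" by auto
  then have "emeasure (stieltjes_measure g) {a..<b} =
      emeasure (interval_measure (\<lambda>x. - g (- x))) {- b<..- a}"
    by (simp add: stieltjes_measure_def emeasure_distr)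
  also have "\<dots> = g b - g a"
    using g ab cont
    by (subst emeasure_interval_measure_Ioc) (auto simp: derivator_def mono_def)
  finally show ?thesis .
qed

primrec g_monomial :: "(real \<Rightarrow> real) \<Rightarrow> real \<Rightarrow> nat \<Rightarrow> real \<Rightarrow> real" where
  "g_monomial g t 0 = (\<lambda>x. 1)"
| "g_monomial g t (Suc n) = (\<lambda>x.
     if t \<le> x then real (Suc n) * (LINT s:{t..<x}|stieltjes_measure g. g_monomial g t n s)
     else - real (Suc n) * (LINT s:{x..<t}|stieltjes_measure g. g_monomial g t n s))"

definition jump :: "(real \<Rightarrow> real) \<Rightarrow> real \<Rightarrow> real" where
  "jump g x = Lim (at_right x) g - g x"

definition D_set :: "(real \<Rightarrow> real) \<Rightarrow> real set" where
  "D_set g = {x. jump g x > 0}"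

definition C_set :: "(real \<Rightarrow> real) \<Rightarrow> real set" where
  "C_set g = {x. \<exists>e>0. g constant_on {x - e<..<x + e}}"

(* The endpoints of the components may be infinite, hence the sets of ereals.  Components are
   nonempty, so einterval a b determines a and b. *)
definition N_minus :: "(real \<Rightarrow> real) \<Rightarrow> ereal set" where
  "N_minus g = {a. \<exists>b. einterval a b \<in> components (C_set g)} - ereal ` D_set g"

definition N_plus :: "(real \<Rightarrow> real) \<Rightarrow> ereal set" where
  "N_plus g = {b. \<exists>a. einterval a b \<in> components (C_set g)} - ereal ` D_set g"

(* The scalar field is any complete multiplicatively normed real field; real and complex are
   instances, and up to isometric isomorphism they are the only ones. *)

definition has_g_derivative ::
  "(real \<Rightarrow> real) \<Rightarrow> (real \<Rightarrow> 'a::{real_normed_field,banach}) \<Rightarrow> 'a \<Rightarrow> real \<Rightarrow> bool" where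
  "has_g_derivative g f D x \<longleftrightarrow>
     (let lim = (\<lambda>z F. ((\<lambda>y. (f y - f z) / of_real (g y - g z)) \<longlongrightarrow> D) F) in
      if x \<in> D_set g then lim x (at_right x)
      else if x \<in> C_set g then
        (\<exists>a b. einterval a (ereal b) \<in> components (C_set g) \<and> x \<in> einterval a (ereal b) \<and>
           lim b (at_right b))
      else if ereal x \<in> N_plus g then lim x (at_right x)
      else if ereal x \<in> N_minus g then lim x (at_left x)
      else lim x (at x))"

definition stieltjes_analytic_on ::
  "(real \<Rightarrow> real) \<Rightarrow> (real \<Rightarrow> 'a::{real_normed_field,banach}) \<Rightarrow> real set \<Rightarrow> bool" where
  "stieltjes_analytic_on g f \<Omega> \<longleftrightarrow> open \<Omega> \<and>
     (\<forall>y\<in>\<Omega>. \<exists>\<delta>>0. \<exists>t. y \<in> {t<..<t + \<delta>} \<and> {t<..<t + \<delta>} \<subseteq> \<Omega> \<and>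
        (\<exists>a. \<forall>x\<in>{t<..<t + \<delta>}.
           summable (\<lambda>n. norm (a n * of_real (g_monomial g t n x))) \<and>
           f x = (\<Sum>n. a n * of_real (g_monomial g t n x))))"

(* Meaningful only where the series converges absolutely, in particular for x \<ge> t. *)
definition exp_series ::
  "(real \<Rightarrow> real) \<Rightarrow> 'a::{real_normed_field,banach} \<Rightarrow> real \<Rightarrow> real \<Rightarrow> 'a" where
  "exp_series g l t x = (\<Sum>n. l ^ n * of_real (g_monomial g t n x) / fact n)"

(* Meaningful if 1 + l * of_real (jump g x) \<noteq> 0 for all x < x0: then the denominators are nonzero
   and the quotient is the same for every admissible t. *)
definition Exp_g ::
  "(real \<Rightarrow> real) \<Rightarrow> 'a::{real_normed_field,banach} \<Rightarrow> real \<Rightarrow> real \<Rightarrow> 'a" where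
  "Exp_g g l x0 x =
     (THE v. \<forall>t<min x x0. v = exp_series g l t x / exp_series g l t x0)"

end

theory Submission
  imports Defs
begin

text \<open>The divided powers \<open>g\<^bsub>t,n\<^esub> / n!\<close> satisfy a binomial identity in the base point, so the Cauchy
  product gives \<open>exp\<^sub>g(t, x) = exp\<^sub>g(t, z) exp\<^sub>g(z, x)\<close> for \<open>t \<le> z \<le> x\<close>. Hence every global claim
  reduces to one about \<open>exp\<^sub>g(z, y)\<close> for \<open>y\<close> near \<open>z\<close>. With \<open>G = g y - g z\<close> and
  \<open>G' = G - \<Delta>g z\<close>, the divided power of order \<open>n + 1\<close> is at most \<open>G G'\<^sup>n\<close>, because the higher ones
  vanish at \<open>z\<close> and only \<open>\<mu>\<^sub>g (z, y) \<le> G'\<close> counts. So \<open>exp\<^sub>g(z, y) = 1 + \<lambda> G + O(G G')\<close>, which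
  yields both the one-sided limits and the derivative, at jumps and at continuity points alike.\<close>

section \<open>Divided powers of a derivator\<close>

definition g_divpow :: "(real \<Rightarrow> real) \<Rightarrow> nat \<Rightarrow> real \<Rightarrow> real \<Rightarrow> real" where
  "g_divpow g n t x = g_monomial g t n x / fact n"

lemma g_divpow_0 [simp]: "g_divpow g 0 t x = 1"
  by (simp add: g_divpow_def)

text \<open>Dividing by the factorial absorbs the factor \<open>Suc n\<close> of the monomial
  recursion, which leaves plain iterated integrals.\<close>

lemma g_divpow_Suc:
  assumes "t \<le> x"
  shows "g_divpow g (Suc n) t x = (LINT s:{t..<x}|stieltjes_measure g. g_divpow g n t s)"
  using assms by (simp add: g_divpow_def del: of_nat_Suc)

lemma g_divpow_Suc_self [simp]: "g_divpow g (Suc n) t t = 0"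
  by (simp add: g_divpow_Suc set_lebesgue_integral_def)

section \<open>One-sided limits, jumps and interval masses\<close>

context
  fixes g :: "real \<Rightarrow> real"
  assumes g: "derivator g"
begin

lemma derivator_mono: "a \<le> b \<Longrightarrow> g a \<le> g b"
  using g by (auto simp: derivator_def mono_def)

lemma derivator_tendsto_left: "(g \<longlongrightarrow> g x) (at_left x)"
  using g by (simp add: derivator_def continuous_within)

text \<open>\<open>jump\<close> rests on \<open>Lim\<close>, which is meaningful only once the limit
  exists; monotonicity supplies it as the infimum of the values to the right.\<close>

lemma derivator_tendsto_right: "(g \<longlongrightarrow> g x + jump g x) (at_right x)"
proof -
  have "(g \<longlongrightarrow> Inf (g ` ({x<..} \<inter> UNIV))) (at x within ({x<..} \<inter> UNIV))"
    by (rule Lim_right_bound[where K = "g x"]) (auto intro: derivator_mono)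
  then have "(g \<longlongrightarrow> Inf (g ` {x<..})) (at_right x)" by simp
  moreover from this have "Lim (at_right x) g = Inf (g ` {x<..})"
    by (intro tendsto_Lim) auto
  ultimately show ?thesis by (simp add: jump_def)
qed

lemma jump_le: "x < y \<Longrightarrow> g x + jump g x \<le> g y"
  by (rule tendsto_upperbound[OF derivator_tendsto_right])
     (auto simp: eventually_at_right intro!: exI[of _ y] derivator_mono)

lemma jump_nonneg: "0 \<le> jump g x"
proof -
  have "g x \<le> g x + jump g x"
    by (rule tendsto_lowerbound[OF derivator_tendsto_right])
       (auto intro!: eventually_mono[OF eventually_at_right_less] derivator_mono)
  then show ?thesis by simp
qed

lemma measure_stieltjes_Ico:
  "a \<le> b \<Longrightarrow> measure (stieltjes_measure g) {a..<b} = g b - g a"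
  using emeasure_stieltjes_measure_Ico[OF g, of a b] derivator_mono[of a b]
  by (simp add: measure_def)

text \<open>Exhaust the open interval by half-open ones starting at
  \<open>a + inverse (real (Suc n))\<close>. There \<open>g\<close> is already at least
  \<open>g a + jump g a\<close>, so the atom at \<open>a\<close> never contributes.\<close>

lemma emeasure_stieltjes_Ioo_le:
  assumes "a < b"
  shows "emeasure (stieltjes_measure g) {a<..<b} \<le> ennreal (g b - g a - jump g a)"
proof -
  define A where "A n = {a + inverse (real (Suc n))..<b}" for n
  have "(\<Union>n. A n) = {a<..<b}"
  proof (intro equalityI subsetI)
    fix x assume "x \<in> {a<..<b}"
    moreover from this obtain n where "inverse (real (Suc n)) < x - a"
      using reals_Archimedean[of "x - a"] by auto
    ultimately show "x \<in> (\<Union>n. A n)" by (auto simp: A_def intro!: exI[of _ n])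
  qed (auto simp: A_def, smt (verit) inverse_positive_iff_positive of_nat_0_le_iff)
  moreover have "incseq A"
    by (auto simp: A_def incseq_def intro!: order.trans[OF add_left_mono] le_imp_inverse_le
        elim!: order.trans[rotated])
  ultimately have "emeasure (stieltjes_measure g) {a<..<b}
      = (SUP n. emeasure (stieltjes_measure g) (A n))"
    by (subst SUP_emeasure_incseq) (auto simp: A_def)
  also have "\<dots> \<le> ennreal (g b - g a - jump g a)"
  proof (rule SUP_least)
    fix n
    let ?c = "a + inverse (real (Suc n))"
    show "emeasure (stieltjes_measure g) (A n) \<le> ennreal (g b - g a - jump g a)"
    proof (cases "?c \<le> b")
      case True
      then have "emeasure (stieltjes_measure g) (A n) = ennreal (g b - g ?c)"
        by (simp only: A_def emeasure_stieltjes_measure_Ico[OF g])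
      also have "\<dots> \<le> ennreal (g b - g a - jump g a)"
        using jump_le[of a ?c] by (intro ennreal_leI) simp
      finally show ?thesis .
    qed (simp add: A_def)
  qed
  finally show ?thesis .
qed

section \<open>Integrability, binomial identity and growth of the divided powers\<close>

lemma set_integrable_const_Ico:
  "set_integrable (stieltjes_measure g) {t..<x} (\<lambda>_. c :: real)"
  by (cases "t \<le> x")
     (auto simp: set_integrable_def emeasure_stieltjes_measure_Ico[OF g])

text \<open>Monotonicity gives measurability and the bound by the value at \<open>x\<close>. It is a
  hypothesis here because its proof at each order uses integrability at the previous one.\<close>

lemma g_divpow_integrable_if_mono:
  assumes mono: "mono_on {t..} (g_divpow g n t)" and nonneg: "\<And>s. t \<le> s \<Longrightarrow> 0 \<le> g_divpow g n t s"
  shows "set_integrable (stieltjes_measure g) {t..<x} (g_divpow g n t)"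
proof -
  have "mono_on {t..<x} (g_divpow g n t)"
    using mono by (rule mono_on_subset) auto
  then have "g_divpow g n t \<in> borel_measurable (restrict_space borel {t..<x})"
    by (rule borel_measurable_mono_on_fnc)
  then have "(\<lambda>s. indicator {t..<x} s *\<^sub>R g_divpow g n t s) \<in> borel_measurable borel"
    by (subst (asm) borel_measurable_restrict_space_iff) auto
  then have "set_borel_measurable (stieltjes_measure g) {t..<x} (g_divpow g n t)"
    by (simp add: set_borel_measurable_def cong: measurable_cong_sets)
  then show ?thesis
    using mono nonneg
    by (intro set_integrable_bound[OF set_integrable_const_Ico[of t x "g_divpow g n t x"]])
       (auto simp: mono_on_def)
qed

text \<open>Both claims go through one induction: at order \<open>n\<close> they give integrability,
  which makes the integral additive over \<open>{t..<x}\<close> and \<open>{x..<y}\<close>, so the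
  increment at order \<open>Suc n\<close> is the integral of a nonnegative function.\<close>

lemma g_divpow_nonneg_mono:
  shows "t \<le> x \<Longrightarrow> 0 \<le> g_divpow g n t x" and "mono_on {t..} (g_divpow g n t)"
proof -
  have "(\<forall>x\<ge>t. 0 \<le> g_divpow g n t x) \<and> mono_on {t..} (g_divpow g n t)"
  proof (induction n)
    case 0
    then show ?case by (simp add: mono_on_def)
  next
    case (Suc n)
    note int = g_divpow_integrable_if_mono[of t n]
    have nn: "0 \<le> (LINT s:A|stieltjes_measure g. g_divpow g n t s)" if "A \<subseteq> {t..}" for A
      unfolding set_lebesgue_integral_def using Suc that
      by (intro Bochner_Integration.integral_nonneg) (auto simp: indicator_def)
    have "g_divpow g (Suc n) t x \<le> g_divpow g (Suc n) t y" if "t \<le> x" "x \<le> y" for x y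
    proof -
      have "g_divpow g (Suc n) t y
          = (LINT s:{t..<x} \<union> {x..<y}|stieltjes_measure g. g_divpow g n t s)"
        using that by (simp add: g_divpow_Suc ivl_disj_un)
      also have "\<dots> = g_divpow g (Suc n) t x
          + (LINT s:{x..<y}|stieltjes_measure g. g_divpow g n t s)"
        using that Suc int
        by (subst set_integral_Un)
           (auto simp: g_divpow_Suc intro: set_integrable_subset[OF int])
      finally show ?thesis using nn[of "{x..<y}"] that by (auto simp: subset_eq)
    qed
    then show ?case
      using nn by (auto simp: g_divpow_Suc mono_on_def subset_eq)
  qed
  then show "t \<le> x \<Longrightarrow> 0 \<le> g_divpow g n t x" "mono_on {t..} (g_divpow g n t)"
    by auto
qed

lemma g_divpow_integrable:
  "set_integrable (stieltjes_measure g) {t..<x} (g_divpow g n t)"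
  by (intro g_divpow_integrable_if_mono g_divpow_nonneg_mono)

lemma g_divpow_1: "t \<le> x \<Longrightarrow> g_divpow g (Suc 0) t x = g x - g t"
  by (simp add: g_divpow_Suc set_integral_const emeasure_stieltjes_measure_Ico[OF g]
      measure_stieltjes_Ico)

text \<open>The analogue of expanding \<open>(a + b) ^ n / fact n\<close>. Splitting the integral at
  \<open>z\<close>, the left piece is the summand \<open>k = Suc n\<close>; on the right piece the
  induction hypothesis applies, and integration raises the order of each factor based at
  \<open>z\<close>.\<close>

lemma g_divpow_binomial:
  assumes "t \<le> z" "z \<le> x"
  shows "g_divpow g n t x = (\<Sum>k\<le>n. g_divpow g k t z * g_divpow g (n - k) z x)"
  using assms(2)
proof (induction n arbitrary: x)
  case (Suc n)
  let ?M = "stieltjes_measure g"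
  have "g_divpow g (Suc n) t x = (LINT s:{t..<z} \<union> {z..<x}|?M. g_divpow g n t s)"
    using assms(1) Suc.prems by (simp add: g_divpow_Suc ivl_disj_un)
  also have "\<dots> = g_divpow g (Suc n) t z + (LINT s:{z..<x}|?M. g_divpow g n t s)"
    using assms(1) Suc.prems
    by (subst set_integral_Un)
       (auto simp: g_divpow_Suc intro: set_integrable_subset[OF g_divpow_integrable[of t x]]
          g_divpow_integrable)
  also have "(LINT s:{z..<x}|?M. g_divpow g n t s)
      = (LINT s:{z..<x}|?M. (\<Sum>k\<le>n. g_divpow g k t z * g_divpow g (n - k) z s))"
    using Suc by (intro set_lebesgue_integral_cong) auto
  also have "\<dots> = (\<Sum>k\<le>n. (LINT s:{z..<x}|?M. g_divpow g k t z * g_divpow g (n - k) z s))"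
    unfolding set_lebesgue_integral_def sum_distrib_left scaleR_sum_right
    by (intro Bochner_Integration.integral_sum g_divpow_integrable[unfolded set_integrable_def]
        set_integrable_mult_right[unfolded set_integrable_def])
  also have "\<dots> = (\<Sum>k\<le>n. g_divpow g k t z * g_divpow g (Suc n - k) z x)"
    using Suc.prems by (intro sum.cong) (auto simp: g_divpow_Suc Suc_diff_le)
  finally show ?case by simp
qed simp

text \<open>The first integration has integrand 1 and sees the atom at \<open>z\<close>, hence one
  full factor \<open>g y - g z\<close>. Each further integrand vanishes at \<open>z\<close>, so the
  atom drops out, and is bounded by its value at \<open>y\<close>.\<close>

lemma g_divpow_le:
  assumes "z < y"
  shows "g_divpow g (Suc n) z y \<le> (g y - g z) * (g y - g z - jump g z) ^ n"
proof (induction n)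
  case 0
  then show ?case using assms by (simp add: g_divpow_1)
next
  case (Suc n)
  let ?M = "stieltjes_measure g" and ?c = "(g y - g z) * (g y - g z - jump g z) ^ n"
  have nn: "0 \<le> ?c" "0 \<le> g y - g z - jump g z"
    using jump_le[OF assms] derivator_mono[of z y] assms by auto
  have Ioo: "emeasure ?M {z<..<y} < \<infinity>" "measure ?M {z<..<y} \<le> g y - g z - jump g z"
    using emeasure_stieltjes_Ioo_le[OF assms] nn
    by (auto simp: measure_def enn2real_leI elim: le_less_trans)
  have "g_divpow g (Suc (Suc n)) z y = (LINT s:{z<..<y}|?M. g_divpow g (Suc n) z s)"
    unfolding g_divpow_Suc[OF less_imp_le[OF assms], of g "Suc n"] set_lebesgue_integral_def
    by (intro Bochner_Integration.integral_cong refl) (auto simp: indicator_def less_le)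
  also have "\<dots> \<le> (LINT s:{z<..<y}|?M. ?c)"
  proof (rule set_integral_mono)
    show "set_integrable ?M {z<..<y} (g_divpow g (Suc n) z)"
      by (rule set_integrable_subset[OF g_divpow_integrable[of z y]]) auto
    show "set_integrable ?M {z<..<y} (\<lambda>_. ?c)"
      using Ioo by (auto simp: set_integrable_def)
    show "g_divpow g (Suc n) z s \<le> ?c" if "s \<in> {z<..<y}" for s
      using g_divpow_nonneg_mono(2)[of z "Suc n"] that Suc assms
      by (auto simp: mono_on_def elim!: order.trans[rotated])
  qed
  also have "\<dots> = measure ?M {z<..<y} * ?c"
    using Ioo by (subst set_integral_const) auto
  also have "\<dots> \<le> (g y - g z - jump g z) * ?c"
    using Ioo nn by (intro mult_right_mono) auto
  finally show ?case by (simp add: mult_ac)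
qed

text \<open>From order 1 on, \<open>g_divpow_le\<close> gives a geometric majorant. Its ratio has
  the jump subtracted, so the condition holds for \<open>y\<close> close to \<open>z\<close> on the
  right, however large the jump.\<close>

lemma summable_g_divpow_if_small:
  assumes "z < y" "0 \<le> c" "c * (g y - g z - jump g z) < 1"
  shows "summable (\<lambda>n. c ^ n * g_divpow g n z y)"
proof -
  let ?q = "c * (g y - g z - jump g z)"
  have "0 \<le> ?q" using jump_le[OF assms(1)] assms(2) by simp
  then have "summable (\<lambda>n. c * (g y - g z) * ?q ^ n)"
    using assms(3) by (intro summable_mult summable_geometric) simp
  moreover have "norm (c ^ Suc n * g_divpow g (Suc n) z y) \<le> c * (g y - g z) * ?q ^ n" for n
    using mult_left_mono[OF g_divpow_le[OF assms(1)], of "c ^ Suc n" n] assms(1,2)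
      g_divpow_nonneg_mono(1)[of z y "Suc n"]
    by (simp add: power_mult_distrib mult_ac)
  ultimately have "summable (\<lambda>n. c ^ Suc n * g_divpow g (Suc n) z y)"
    by (rule summable_comparison_test'[where N = 0])
  then show ?thesis
    by (rule iffD1[OF summable_Suc_iff[of "\<lambda>n. c ^ n * g_divpow g n z y"]])
qed

text \<open>Locally on either side of a point the measure of \<open>(z, y)\<close> is small, so the series is dominated
  by a geometric one; the Cauchy product glues the local statements.\<close>

lemma summable_g_divpow:
  assumes "t \<le> x" "0 \<le> c"
  shows "summable (\<lambda>n. c ^ n * g_divpow g n t x)"
proof -
  have glue: "summable (\<lambda>n. c ^ n * g_divpow g n p r)"
    if "summable (\<lambda>n. c ^ n * g_divpow g n p q)" "summable (\<lambda>n. c ^ n * g_divpow g n q r)"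
      "p \<le> q" "q \<le> r" for p q r
  proof -
    have "summable (\<lambda>n. \<Sum>k\<le>n. (c ^ k * g_divpow g k p q) * (c ^ (n - k) * g_divpow g (n - k) q r))"
      using that assms(2) g_divpow_nonneg_mono(1)
      by (intro summable_Cauchy_product) (simp_all add: abs_mult)
    also have "(\<lambda>n. \<Sum>k\<le>n. (c ^ k * g_divpow g k p q) * (c ^ (n - k) * g_divpow g (n - k) q r))
        = (\<lambda>n. c ^ n * g_divpow g n p r)"
    proof
      fix n
      have "(c ^ k * g_divpow g k p q) * (c ^ (n - k) * g_divpow g (n - k) q r)
          = c ^ n * (g_divpow g k p q * g_divpow g (n - k) q r)" if "k \<le> n" for k
        using power_add[of c k "n - k"] that by simp
      then show "(\<Sum>k\<le>n. (c ^ k * g_divpow g k p q) * (c ^ (n - k) * g_divpow g (n - k) q r))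
          = c ^ n * g_divpow g n p r"
        unfolding g_divpow_binomial[OF that(3,4)] sum_distrib_left by (intro sum.cong) auto
    qed
    finally show ?thesis .
  qed
  from assms(1) show ?thesis
  proof (induction rule: Bolzano)
    case (trans p q r)
    then show ?case by (rule glue)
  next
    case (local z)
    have "((\<lambda>y. c * (g y - g z - jump g z)) \<longlongrightarrow> c * (g z + jump g z - g z - jump g z)) (at_right z)"
      by (intro tendsto_intros derivator_tendsto_right)
    then have "\<forall>\<^sub>F y in at_right z. c * (g y - g z - jump g z) < 1"
      by (rule order_tendstoD) simp
    then obtain b where b: "b > z" "\<And>y. z < y \<Longrightarrow> y < b \<Longrightarrow> c * (g y - g z - jump g z) < 1"
      unfolding eventually_at_right_field by blast
    have "((\<lambda>y. c * (g z - g y)) \<longlongrightarrow> c * (g z - g z)) (at_left z)"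
      by (intro tendsto_intros derivator_tendsto_left)
    then have "\<forall>\<^sub>F y in at_left z. c * (g z - g y) < 1"
      by (rule order_tendstoD) simp
    then obtain a where a: "a < z" "\<And>y. a < y \<Longrightarrow> y < z \<Longrightarrow> c * (g z - g y) < 1"
      unfolding eventually_at_left_field by blast
    have right: "summable (\<lambda>n. c ^ n * g_divpow g n z y)" if "z < y" "y < b" for y
      using summable_g_divpow_if_small[of z y c] b that assms(2) by auto
    have left: "summable (\<lambda>n. c ^ n * g_divpow g n y z)" if "a < y" "y < z" for y
    proof (rule summable_g_divpow_if_small)
      \<comment> \<open>Here the base point \<open>y\<close> moves; its jump only lowers the
        left-hand side, and left continuity at \<open>z\<close> makes \<open>g z - g y\<close>
        small.\<close>
      have "c * (g z - g y - jump g y) \<le> c * (g z - g y)"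
        using assms(2) jump_nonneg[of y] by (intro mult_left_mono) auto
      then show "c * (g z - g y - jump g y) < 1" using a(2)[OF that] by linarith
    qed (use that assms in auto)
    \<comment> \<open>The short interval around \<open>z\<close> may have \<open>z\<close> as an end
      point.\<close>
    have self: "summable (\<lambda>n. c ^ n * g_divpow g n z z)"
      by (rule iffD1[OF summable_Suc_iff[of "\<lambda>n. c ^ n * g_divpow g n z z"]]) simp
    show ?case
    proof (intro exI[of _ "min (b - z) (z - a)"] conjI allI impI)
      fix p q assume pq: "p \<le> z \<and> z \<le> q \<and> q - p < min (b - z) (z - a)"
      have "summable (\<lambda>n. c ^ n * g_divpow g n p z)" "summable (\<lambda>n. c ^ n * g_divpow g n z q)"
        using left[of p] right[of q] self pq by (cases "p = z"; cases "q = z"; auto)+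
      then show "summable (\<lambda>n. c ^ n * g_divpow g n p q)"
        by (rule glue) (use pq in auto)
    qed (use a b in auto)
  qed
qed

end

section \<open>The exponential series: multiplicativity, local expansion and zeros\<close>

lemma exp_series_eq_suminf: "exp_series g l t x = (\<Sum>n. l ^ n * of_real (g_divpow g n t x))"
  by (simp add: exp_series_def g_divpow_def of_real_divide)

lemma exp_series_self [simp]: "exp_series g l t t = 1"
proof -
  have "(\<Sum>n. l ^ n * of_real (g_divpow g n t t)) = (\<Sum>n\<in>{0}. l ^ n * of_real (g_divpow g n t t))"
    by (intro suminf_finite) (auto simp: gr0_conv_Suc)
  then show ?thesis by (simp add: exp_series_eq_suminf)
qed

lemma eventually_at_left_less: "\<forall>\<^sub>F y in at_left z. y < (z :: real)"
  by (simp add: eventually_at_filter)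

context
  fixes g :: "real \<Rightarrow> real"
    and l :: "'a::{real_normed_field,banach}"
  assumes g: "derivator g"
begin

lemma summable_norm_exp_series:
  "t \<le> x \<Longrightarrow> summable (\<lambda>n. norm (l ^ n * of_real (g_divpow g n t x)))"
  using summable_g_divpow[OF g, of t x "norm l"] g_divpow_nonneg_mono(1)[OF g, of t x]
  by (simp add: norm_mult norm_power)

lemma exp_series_mult:
  assumes "t \<le> z" "z \<le> x"
  shows "exp_series g l t x = exp_series g l t z * exp_series g l z x"
proof -
  have "(l ^ k * of_real (g_divpow g k t z)) * (l ^ (n - k) * of_real (g_divpow g (n - k) z x))
      = l ^ n * of_real (g_divpow g k t z * g_divpow g (n - k) z x)" if "k \<le> n" for k n
    using power_add[of l k "n - k"] that by simp
  then have "(\<Sum>k\<le>n. (l ^ k * of_real (g_divpow g k t z))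
        * (l ^ (n - k) * of_real (g_divpow g (n - k) z x)))
      = l ^ n * of_real (g_divpow g n t x)" for n
    unfolding g_divpow_binomial[OF g assms] of_real_sum sum_distrib_left
    by (intro sum.cong) auto
  then show ?thesis
    unfolding exp_series_eq_suminf
    by (subst Cauchy_product) (use assms summable_norm_exp_series in auto)
qed

text \<open>Orders 0 and 1 are exact. The tail is dominated by a geometric series of ratio at most
  1/2, whose sum is at most twice its first term: hence the factor 2.\<close>

lemma exp_series_first_order:
  assumes "z < y" "norm l * (g y - g z - jump g z) \<le> 1 / 2"
  shows "norm (exp_series g l z y - 1 - l * of_real (g y - g z))
    \<le> 2 * (norm l)\<^sup>2 * (g y - g z) * (g y - g z - jump g z)"
proof -
  let ?c = "norm l" and ?G = "g y - g z" and ?G' = "g y - g z - jump g z"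
  let ?q = "?c * ?G'" and ?f = "\<lambda>n. l ^ n * of_real (g_divpow g n z y)"
  have G: "0 \<le> ?G" "0 \<le> ?G'"
    using jump_le[OF g assms(1)] derivator_mono[OF g, of z y] assms(1) by auto
  have q: "0 \<le> ?q" "?q \<le> 1 / 2" using G assms(2) by auto
  have sum: "summable (\<lambda>n. norm (?f n))"
    using assms(1) by (intro summable_norm_exp_series) simp
  then have sum2: "summable (\<lambda>n. norm (?f (n + 2)))"
    by (rule summable_ignore_initial_segment)
  have "exp_series g l z y = (\<Sum>n. ?f (n + 2)) + sum ?f {..<2}"
    unfolding exp_series_eq_suminf
    by (rule suminf_split_initial_segment[OF summable_norm_cancel[OF sum]])
  then have "norm (exp_series g l z y - 1 - l * of_real ?G) = norm (\<Sum>n. ?f (n + 2))"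
    using assms(1) by (simp add: numeral_2_eq_2 g_divpow_1[OF g])
  also have "\<dots> \<le> (\<Sum>n. norm (?f (n + 2)))"
    by (rule summable_norm[OF sum2])
  also have "\<dots> \<le> (\<Sum>n. ?c\<^sup>2 * ?G * ?G' * ?q ^ n)"
  proof (rule suminf_le[OF _ sum2])
    show "norm (?f (n + 2)) \<le> ?c\<^sup>2 * ?G * ?G' * ?q ^ n" for n
    proof -
      have "norm (?f (n + 2)) = ?c ^ (n + 2) * g_divpow g (Suc (Suc n)) z y"
        using g_divpow_nonneg_mono(1)[OF g, of z y "Suc (Suc n)"] assms(1)
        by (simp add: norm_mult norm_power)
      also have "\<dots> \<le> ?c ^ (n + 2) * (?G * ?G' ^ Suc n)"
        by (intro mult_left_mono g_divpow_le[OF g] assms(1)) simp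
      also have "\<dots> = ?c\<^sup>2 * ?G * ?G' * ?q ^ n"
        by (simp add: power_add power_mult_distrib power2_eq_square)
      finally show ?thesis .
    qed
    show "summable (\<lambda>n. ?c\<^sup>2 * ?G * ?G' * ?q ^ n)"
      using q by (intro summable_mult summable_geometric) simp
  qed
  also have "\<dots> = ?c\<^sup>2 * ?G * ?G' * (1 / (1 - ?q))"
    using q by (subst suminf_mult) (auto simp: suminf_geometric intro!: summable_geometric)
  also have "\<dots> \<le> ?c\<^sup>2 * ?G * ?G' * 2"
  proof (rule mult_left_mono)
    have "1 / (1 - ?q) \<le> 1 / (1 / 2)"
      using q by (intro frac_le) linarith+
    then show "1 / (1 - ?q) \<le> 2" by simp
  qed (use G in simp)
  finally show ?thesis by (simp add: mult_ac)
qed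

lemma eventually_small_right:
  "\<forall>\<^sub>F y in at_right z. norm l * (g y - g z - jump g z) \<le> 1 / 2"
proof -
  have "((\<lambda>y. norm l * (g y - g z - jump g z)) \<longlongrightarrow> norm l * (g z + jump g z - g z - jump g z))
      (at_right z)"
    by (intro tendsto_intros derivator_tendsto_right[OF g])
  then have "\<forall>\<^sub>F y in at_right z. norm l * (g y - g z - jump g z) < 1 / 2"
    by (rule order_tendstoD) simp
  then show ?thesis by eventually_elim simp
qed

lemma eventually_small_left:
  "\<forall>\<^sub>F y in at_left z. norm l * (g z - g y - jump g y) \<le> 1 / 2"
proof -
  have "((\<lambda>y. norm l * (g z - g y)) \<longlongrightarrow> norm l * (g z - g z)) (at_left z)"
    by (intro tendsto_intros derivator_tendsto_left[OF g])
  then have "\<forall>\<^sub>F y in at_left z. norm l * (g z - g y) < 1 / 2"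
    by (rule order_tendstoD) simp
  then show ?thesis
  proof eventually_elim
    case (elim y)
    have "norm l * (g z - g y - jump g y) \<le> norm l * (g z - g y)"
      using jump_nonneg[OF g, of y] by (intro mult_left_mono) auto
    with elim show ?case by linarith
  qed
qed

text \<open>Strict growth permits division by \<open>g y - g z\<close>. This cancels one factor of
  the remainder and leaves a multiple of \<open>g y - g z - jump g z\<close>, which tends to 0
  whether or not \<open>z\<close> is a jump.\<close>

lemma exp_series_quotient_right:
  assumes inc: "\<And>y. z < y \<Longrightarrow> g z < g y"
  shows "((\<lambda>y. (exp_series g l z y - 1) / of_real (g y - g z)) \<longlongrightarrow> l) (at_right z)"
proof (rule Lim_transform2[OF tendsto_const])
  show "((\<lambda>y. l - (exp_series g l z y - 1) / of_real (g y - g z)) \<longlongrightarrow> 0) (at_right z)"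
  proof (rule Lim_null_comparison)
    have "((\<lambda>y. 2 * (norm l)\<^sup>2 * (g y - g z - jump g z))
        \<longlongrightarrow> 2 * (norm l)\<^sup>2 * (g z + jump g z - g z - jump g z)) (at_right z)"
      by (intro tendsto_intros derivator_tendsto_right[OF g])
    then show "((\<lambda>y. 2 * (norm l)\<^sup>2 * (g y - g z - jump g z)) \<longlongrightarrow> 0) (at_right z)" by simp
    show "\<forall>\<^sub>F y in at_right z. norm (l - (exp_series g l z y - 1) / of_real (g y - g z))
        \<le> 2 * (norm l)\<^sup>2 * (g y - g z - jump g z)"
      using eventually_small_right eventually_at_right_less
    proof eventually_elim
      case (elim y)
      have G: "0 < g y - g z" using inc elim by simp
      then have "l - (exp_series g l z y - 1) / of_real (g y - g z)
          = - (exp_series g l z y - 1 - l * of_real (g y - g z)) / of_real (g y - g z)"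
        by (simp add: field_simps flip: of_real_diff)
      then have "norm (l - (exp_series g l z y - 1) / of_real (g y - g z))
          = norm (exp_series g l z y - 1 - l * of_real (g y - g z)) / (g y - g z)"
        using G by (simp only: norm_divide norm_minus_cancel norm_of_real abs_of_pos)
      also have "\<dots> \<le> (2 * (norm l)\<^sup>2 * (g y - g z) * (g y - g z - jump g z)) / (g y - g z)"
        using exp_series_first_order[of z y] elim G by (intro divide_right_mono) auto
      finally show ?case using G by simp
    qed
  qed
qed

text \<open>The expansion is taken at the moving base point \<open>y\<close>; its jump is discarded
  and left continuity at \<open>z\<close> controls the rest.\<close>

lemma exp_series_quotient_left:
  assumes inc: "\<And>y. y < z \<Longrightarrow> g y < g z"
  shows "((\<lambda>y. (exp_series g l y z - 1) / of_real (g z - g y)) \<longlongrightarrow> l) (at_left z)"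
proof (rule Lim_transform2[OF tendsto_const])
  show "((\<lambda>y. l - (exp_series g l y z - 1) / of_real (g z - g y)) \<longlongrightarrow> 0) (at_left z)"
  proof (rule Lim_null_comparison)
    have "((\<lambda>y. 2 * (norm l)\<^sup>2 * (g z - g y)) \<longlongrightarrow> 2 * (norm l)\<^sup>2 * (g z - g z)) (at_left z)"
      by (intro tendsto_intros derivator_tendsto_left[OF g])
    then show "((\<lambda>y. 2 * (norm l)\<^sup>2 * (g z - g y)) \<longlongrightarrow> 0) (at_left z)" by simp
    show "\<forall>\<^sub>F y in at_left z. norm (l - (exp_series g l y z - 1) / of_real (g z - g y))
        \<le> 2 * (norm l)\<^sup>2 * (g z - g y)"
      using eventually_small_left eventually_at_left_less
    proof eventually_elim
      case (elim y)
      have G: "0 < g z - g y" using inc elim by simp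
      then have "l - (exp_series g l y z - 1) / of_real (g z - g y)
          = - (exp_series g l y z - 1 - l * of_real (g z - g y)) / of_real (g z - g y)"
        by (simp add: field_simps flip: of_real_diff)
      then have "norm (l - (exp_series g l y z - 1) / of_real (g z - g y))
          = norm (exp_series g l y z - 1 - l * of_real (g z - g y)) / (g z - g y)"
        using G by (simp only: norm_divide norm_minus_cancel norm_of_real abs_of_pos)
      also have "\<dots> \<le> (2 * (norm l)\<^sup>2 * (g z - g y) * (g z - g y - jump g y)) / (g z - g y)"
        using exp_series_first_order[of y z] elim G by (intro divide_right_mono) auto
      also have "\<dots> \<le> 2 * (norm l)\<^sup>2 * (g z - g y)"
        using G jump_nonneg[OF g, of y] by simp (intro mult_left_mono; simp)
      finally show ?case .
    qed
  qed
qed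

text \<open>The limit is the factor gained in crossing \<open>z\<close>: the remainder disappears,
  while the linear term keeps the jump.\<close>

lemma exp_series_tendsto_right:
  "((\<lambda>y. exp_series g l z y) \<longlongrightarrow> 1 + l * of_real (jump g z)) (at_right z)"
proof -
  have 1: "((\<lambda>y. exp_series g l z y - 1 - l * of_real (g y - g z)) \<longlongrightarrow> 0) (at_right z)"
  proof (rule Lim_null_comparison)
    have "((\<lambda>y. 2 * (norm l)\<^sup>2 * (g y - g z) * (g y - g z - jump g z))
        \<longlongrightarrow> 2 * (norm l)\<^sup>2 * (g z + jump g z - g z) * (g z + jump g z - g z - jump g z)) (at_right z)"
      by (intro tendsto_intros derivator_tendsto_right[OF g])
    then show "((\<lambda>y. 2 * (norm l)\<^sup>2 * (g y - g z) * (g y - g z - jump g z)) \<longlongrightarrow> 0) (at_right z)"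
      by simp
    show "\<forall>\<^sub>F y in at_right z. norm (exp_series g l z y - 1 - l * of_real (g y - g z))
        \<le> 2 * (norm l)\<^sup>2 * (g y - g z) * (g y - g z - jump g z)"
      using eventually_small_right eventually_at_right_less
      by eventually_elim (rule exp_series_first_order)
  qed
  have 2: "((\<lambda>y. 1 + l * of_real (g y - g z)) \<longlongrightarrow> 1 + l * of_real (g z + jump g z - g z)) (at_right z)"
    by (intro tendsto_intros derivator_tendsto_right[OF g])
  show ?thesis using tendsto_add[OF 1 2] by simp
qed

lemma exp_series_tendsto_left: "((\<lambda>y. exp_series g l y z) \<longlongrightarrow> 1) (at_left z)"
proof -
  have 1: "((\<lambda>y. exp_series g l y z - 1 - l * of_real (g z - g y)) \<longlongrightarrow> 0) (at_left z)"
  proof (rule Lim_null_comparison)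
    have "((\<lambda>y. 2 * (norm l)\<^sup>2 * (g z - g y) * (g z - g y))
        \<longlongrightarrow> 2 * (norm l)\<^sup>2 * (g z - g z) * (g z - g z)) (at_left z)"
      by (intro tendsto_intros derivator_tendsto_left[OF g])
    then show "((\<lambda>y. 2 * (norm l)\<^sup>2 * (g z - g y) * (g z - g y)) \<longlongrightarrow> 0) (at_left z)"
      by simp
    show "\<forall>\<^sub>F y in at_left z. norm (exp_series g l y z - 1 - l * of_real (g z - g y))
        \<le> 2 * (norm l)\<^sup>2 * (g z - g y) * (g z - g y)"
      using eventually_small_left eventually_at_left_less
    proof eventually_elim
      case (elim y)
      have "2 * (norm l)\<^sup>2 * (g z - g y) * (g z - g y - jump g y)
          \<le> 2 * (norm l)\<^sup>2 * (g z - g y) * (g z - g y)"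
        using derivator_mono[OF g, of y z] jump_nonneg[OF g, of y] elim
        by (intro mult_left_mono) auto
      then show ?case using exp_series_first_order[of y z] elim by linarith
    qed
  qed
  have 2: "((\<lambda>y. 1 + l * of_real (g z - g y)) \<longlongrightarrow> 1 + l * of_real (g z - g z)) (at_left z)"
    by (intro tendsto_intros derivator_tendsto_left[OF g])
  show ?thesis using tendsto_add[OF 1 2] by simp
qed

text \<open>Equal values of \<open>g\<close> force the jump at \<open>z\<close> to vanish, and the
  first-order bound becomes 0.\<close>

lemma exp_series_eq_1:
  assumes "z \<le> y" "g z = g y"
  shows "exp_series g l z y = 1"
proof (cases "z = y")
  case False
  with assms have "z < y" by simp
  moreover have "jump g z = 0"
    using jump_le[OF g \<open>z < y\<close>] jump_nonneg[OF g, of z] assms by simp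
  ultimately show ?thesis using exp_series_first_order[of z y] assms by simp
qed simp

text \<open>Products inherit non-vanishing, so by Bolzano's principle short intervals around each
  \<open>z\<close> suffice. There the left factor is close to 1 and the right one to
  \<open>1 + l * of_real (jump g z)\<close>.\<close>

lemma exp_series_nonzero:
  assumes "t \<le> x" and nz: "\<And>s. s < x \<Longrightarrow> 1 + l * of_real (jump g s) \<noteq> 0"
  shows "exp_series g l t x \<noteq> 0"
proof -
  \<comment> \<open>The trivial premise becomes the guard \<open>q \<le> x\<close> in the induction:
    short intervals may extend past \<open>x\<close>, where the jumps are not controlled.\<close>
  from assms(1) have "x \<le> x \<longrightarrow> exp_series g l t x \<noteq> 0"
  proof (induction rule: Bolzano[where P = "\<lambda>p q. q \<le> x \<longrightarrow> exp_series g l p q \<noteq> 0"])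
    case (trans p q r)
    then show ?case by (auto simp: exp_series_mult[of p q r])
  next
    case (local z)
    obtain b where b: "b > z" "\<And>y. z < y \<Longrightarrow> y < b \<Longrightarrow> y \<le> x \<Longrightarrow> exp_series g l z y \<noteq> 0"
    proof (cases "z < x")
      case True
      then have "\<forall>\<^sub>F y in at_right z. exp_series g l z y \<noteq> 0"
        by (intro tendsto_imp_eventually_ne[OF exp_series_tendsto_right] nz)
      then show ?thesis using that unfolding eventually_at_right_field by blast
    \<comment> \<open>For \<open>z \<ge> x\<close> no \<open>y\<close> satisfies
      \<open>z < y\<close> and \<open>y \<le> x\<close>, so any \<open>b > z\<close> serves.\<close>
    qed (use that[of "z + 1"] in auto)
    have "\<forall>\<^sub>F y in at_left z. exp_series g l y z \<noteq> 0"
      by (intro tendsto_imp_eventually_ne[OF exp_series_tendsto_left]) simp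
    then obtain a where a: "a < z" "\<And>y. a < y \<Longrightarrow> y < z \<Longrightarrow> exp_series g l y z \<noteq> 0"
      unfolding eventually_at_left_field by blast
    show ?case
    proof (intro exI[of _ "min (b - z) (z - a)"] conjI allI impI)
      fix p q assume pq: "p \<le> z \<and> z \<le> q \<and> q - p < min (b - z) (z - a)" and "q \<le> x"
      have "exp_series g l p z \<noteq> 0" "exp_series g l z q \<noteq> 0"
        using a(2)[of p] b(2)[of q] pq \<open>q \<le> x\<close> by (cases "p = z"; cases "q = z"; auto)+
      then show "exp_series g l p q \<noteq> 0"
        using exp_series_mult[of p z q] pq by simp
    qed (use a b in auto)
  qed
  then show ?thesis by simp
qed

section \<open>The normalised exponential\<close>

context
  fixes x0 :: real
  assumes nz: "\<And>x. x < x0 \<Longrightarrow> 1 + l * of_real (jump g x) \<noteq> 0"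
begin

text \<open>Shows that the \<open>THE\<close> in \<open>Exp_g\<close> is well defined: moving the
  base point from \<open>s\<close> to \<open>r\<close> cancels the common factor
  \<open>exp_series g l s r\<close>, nonzero because everything below \<open>r\<close> lies below
  \<open>x0\<close>.\<close>

lemma Exp_g_eq:
  assumes t: "t < min x x0"
  shows "Exp_g g l x0 x = exp_series g l t x / exp_series g l t x0"
proof -
  have shift: "exp_series g l s x / exp_series g l s x0 = exp_series g l r x / exp_series g l r x0"
    if "s \<le> r" "r < min x x0" for s r
  proof -
    have "exp_series g l s r \<noteq> 0"
      using that nz by (intro exp_series_nonzero) auto
    then show ?thesis
      using that by (simp add: exp_series_mult[of s r x] exp_series_mult[of s r x0])
  qed
  have indep: "exp_series g l s x / exp_series g l s x0 = exp_series g l t x / exp_series g l t x0"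
    if "s < min x x0" for s
  proof (cases "s \<le> t")
    case True
    then show ?thesis using t by (rule shift)
  next
    case False
    then have "t \<le> s" by simp
    then show ?thesis using that by (rule shift[symmetric])
  qed
  show ?thesis
    unfolding Exp_g_def
  proof (rule the_equality)
    show "\<forall>s<min x x0. exp_series g l t x / exp_series g l t x0
        = exp_series g l s x / exp_series g l s x0"
      using indep by metis
  qed (use t in blast)
qed

lemma Exp_g_self: "Exp_g g l x0 x0 = 1"
proof -
  have "exp_series g l (x0 - 1) x0 \<noteq> 0"
    using nz by (intro exp_series_nonzero) auto
  then show ?thesis
    using Exp_g_eq[of "x0 - 1" x0] by simp
qed

text \<open>One base point left of \<open>z\<close> and \<open>x0\<close> serves both values. The
  rule transfers the local estimates to \<open>Exp_g\<close>, also to the right of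
  \<open>x0\<close>, where the series may vanish.\<close>

lemma Exp_g_mult:
  assumes "z \<le> y"
  shows "Exp_g g l x0 y = Exp_g g l x0 z * exp_series g l z y"
proof -
  define t where "t = min z x0 - 1"
  have "t < min y x0" "t < min z x0" "t \<le> z" using assms by (auto simp: t_def)
  then show ?thesis
    using assms by (simp add: Exp_g_eq[of t y] Exp_g_eq[of t z] exp_series_mult[of t z y])
qed

lemma Exp_g_quotient_right:
  assumes "\<And>y. z < y \<Longrightarrow> g z < g y"
  shows "((\<lambda>y. (Exp_g g l x0 y - Exp_g g l x0 z) / of_real (g y - g z))
    \<longlongrightarrow> l * Exp_g g l x0 z) (at_right z)"
proof (rule Lim_transform_eventually)
  show "((\<lambda>y. (exp_series g l z y - 1) / of_real (g y - g z) * Exp_g g l x0 z)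
      \<longlongrightarrow> l * Exp_g g l x0 z) (at_right z)"
    by (intro tendsto_intros exp_series_quotient_right assms)
  show "\<forall>\<^sub>F y in at_right z. (exp_series g l z y - 1) / of_real (g y - g z) * Exp_g g l x0 z
      = (Exp_g g l x0 y - Exp_g g l x0 z) / of_real (g y - g z)"
    using eventually_at_right_less
  proof eventually_elim
    case (elim y)
    then have "Exp_g g l x0 y - Exp_g g l x0 z = (exp_series g l z y - 1) * Exp_g g l x0 z"
      by (subst Exp_g_mult[of z y]) (simp_all add: right_diff_distrib mult.commute)
    then show ?case by (simp only: times_divide_eq_left)
  qed
qed

lemma Exp_g_tendsto_left: "(Exp_g g l x0 \<longlongrightarrow> Exp_g g l x0 z) (at_left z)"
proof (rule Lim_transform_eventually)
  have "((\<lambda>y. Exp_g g l x0 z / exp_series g l y z) \<longlongrightarrow> Exp_g g l x0 z / 1) (at_left z)"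
    by (intro tendsto_intros exp_series_tendsto_left) simp
  then show "((\<lambda>y. Exp_g g l x0 z / exp_series g l y z) \<longlongrightarrow> Exp_g g l x0 z) (at_left z)"
    by simp
  have "\<forall>\<^sub>F y in at_left z. exp_series g l y z \<noteq> 0"
    by (intro tendsto_imp_eventually_ne[OF exp_series_tendsto_left]) simp
  then show "\<forall>\<^sub>F y in at_left z. Exp_g g l x0 z / exp_series g l y z = Exp_g g l x0 y"
    using eventually_at_left_less
  proof eventually_elim
    case (elim y)
    then show ?case by (simp add: Exp_g_mult[of y z])
  qed
qed

text \<open>With a moving base point the quotient carries the factor \<open>Exp_g g l x0 y\<close>
  rather than the value at \<open>z\<close>, which is why \<open>Exp_g_tendsto_left\<close> is
  needed.\<close>

lemma Exp_g_quotient_left: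
  assumes "\<And>y. y < z \<Longrightarrow> g y < g z"
  shows "((\<lambda>y. (Exp_g g l x0 y - Exp_g g l x0 z) / of_real (g y - g z))
    \<longlongrightarrow> l * Exp_g g l x0 z) (at_left z)"
proof (rule Lim_transform_eventually)
  show "((\<lambda>y. (exp_series g l y z - 1) / of_real (g z - g y) * Exp_g g l x0 y)
      \<longlongrightarrow> l * Exp_g g l x0 z) (at_left z)"
    by (intro tendsto_intros exp_series_quotient_left Exp_g_tendsto_left assms)
  show "\<forall>\<^sub>F y in at_left z. (exp_series g l y z - 1) / of_real (g z - g y) * Exp_g g l x0 y
      = (Exp_g g l x0 y - Exp_g g l x0 z) / of_real (g y - g z)"
    using eventually_at_left_less
  proof eventually_elim
    case (elim y)
    have "(exp_series g l y z - 1) / of_real (g z - g y) * Exp_g g l x0 y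
        = (Exp_g g l x0 z - Exp_g g l x0 y) / of_real (g z - g y)"
      using elim by (subst Exp_g_mult[of y z]) (simp_all add: right_diff_distrib mult.commute)
    also have "\<dots> = - (Exp_g g l x0 z - Exp_g g l x0 y) / - of_real (g z - g y)"
      by (simp only: minus_divide_divide)
    also have "\<dots> = (Exp_g g l x0 y - Exp_g g l x0 z) / of_real (g y - g z)"
      by (simp flip: of_real_minus)
    finally show ?case .
  qed
qed

text \<open>With \<open>t\<close> left of \<open>y\<close> and \<open>x0\<close>, the defining
  quotient is itself the required expansion: the exponential series divided by the constant
  \<open>c\<close>.\<close>

lemma Exp_g_analytic: "stieltjes_analytic_on g (Exp_g g l x0) UNIV"
  unfolding stieltjes_analytic_on_def
proof (intro conjI ballI)
  fix y :: real
  define t where "t = min y x0 - 1"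
  define c where "c = exp_series g l t x0"
  have expand: "summable (\<lambda>n. norm (l ^ n / fact n / c * of_real (g_monomial g t n x)))
      \<and> Exp_g g l x0 x = (\<Sum>n. l ^ n / fact n / c * of_real (g_monomial g t n x))"
    if "t < x" for x
  proof -
    have eq: "l ^ n / fact n / c * of_real (g_monomial g t n x)
        = l ^ n * of_real (g_divpow g n t x) / c" for n
      by (simp add: g_divpow_def of_real_divide)
    have sum: "summable (\<lambda>n. norm (l ^ n * of_real (g_divpow g n t x)))"
      using that by (intro summable_norm_exp_series) simp
    have "Exp_g g l x0 x = (\<Sum>n. l ^ n * of_real (g_divpow g n t x)) / c"
      using that Exp_g_eq[of t x] by (simp add: t_def c_def exp_series_eq_suminf)
    also have "\<dots> = (\<Sum>n. l ^ n * of_real (g_divpow g n t x) / c)"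
      by (rule suminf_divide[OF summable_norm_cancel[OF sum], symmetric])
    finally show ?thesis
      using summable_divide[OF sum, of "norm c"] unfolding eq by (simp add: norm_divide)
  qed
  show "\<exists>\<delta>>0. \<exists>t. y \<in> {t<..<t + \<delta>} \<and> {t<..<t + \<delta>} \<subseteq> UNIV \<and>
      (\<exists>a. \<forall>x\<in>{t<..<t + \<delta>}.
        summable (\<lambda>n. norm (a n * of_real (g_monomial g t n x))) \<and>
        Exp_g g l x0 x = (\<Sum>n. a n * of_real (g_monomial g t n x)))"
  proof (intro exI conjI)
    \<comment> \<open>The expansion holds for all \<open>x > t\<close>, so any length exceeding
      \<open>y - t\<close> would do.\<close>
    show "y - t + 1 > 0" "y \<in> {t<..<t + (y - t + 1)}" by (auto simp: t_def)
    show "\<forall>x\<in>{t<..<t + (y - t + 1)}.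
        summable (\<lambda>n. norm (l ^ n / fact n / c * of_real (g_monomial g t n x))) \<and>
        Exp_g g l x0 x = (\<Sum>n. l ^ n / fact n / c * of_real (g_monomial g t n x))"
      using expand by simp
  qed simp
qed simp

end

end

section \<open>Components of the set of local constancy\<close>

lemma einterval_interval:
  "p \<in> einterval a b \<Longrightarrow> q \<in> einterval a b \<Longrightarrow> {p..q} \<subseteq> einterval a b"
  by (auto simp: einterval_iff) (meson ereal_less_eq(3) less_le_trans le_less_trans)+

text \<open>Openness keeps the points strictly between infimum and supremum; connectedness fills the
  gap. Extended reals admit unbounded sets.\<close>

lemma open_connected_real_eq_einterval:
  fixes K :: "real set"
  assumes "open K" "connected K"
  shows "K = einterval (Inf (ereal ` K)) (Sup (ereal ` K))"
proof (intro equalityI subsetI)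
  fix z assume z: "z \<in> K"
  then obtain e where e: "e > 0" "cball z e \<subseteq> K"
    using assms(1) open_contains_cball by blast
  then have "z - e \<in> K" "z + e \<in> K" by (auto simp: dist_real_def subset_eq)
  then have "Inf (ereal ` K) \<le> ereal (z - e)" "ereal (z + e) \<le> Sup (ereal ` K)"
    by (auto intro: Inf_lower Sup_upper)
  moreover have "ereal (z - e) < ereal z" "ereal z < ereal (z + e)" using e by auto
  ultimately show "z \<in> einterval (Inf (ereal ` K)) (Sup (ereal ` K))"
    unfolding einterval_iff by (meson le_less_trans less_le_trans)
next
  fix z assume "z \<in> einterval (Inf (ereal ` K)) (Sup (ereal ` K))"
  then obtain p q where "p \<in> K" "q \<in> K" "p < z" "z < q"
    by (auto simp: einterval_iff Inf_less_iff less_Sup_iff)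
  then show "z \<in> K"
    using assms(2) by (meson connectedD_interval less_imp_le)
qed

lemma open_C_set: "open (C_set g)"
  unfolding open_dist
proof
  fix x assume "x \<in> C_set g"
  then obtain e where e: "e > 0" "g constant_on {x - e<..<x + e}"
    by (auto simp: C_set_def)
  have "y \<in> C_set g" if "dist y x < e / 2" for y
  proof -
    have "{y - e / 2<..<y + e / 2} \<subseteq> {x - e<..<x + e}"
      using that by (auto simp: dist_real_def abs_if split: if_splits)
    then have "g constant_on {y - e / 2<..<y + e / 2}"
      by (rule constant_on_subset[OF e(2)])
    then show ?thesis
      using e(1) unfolding C_set_def by (intro CollectI exI[of _ "e / 2"]) simp
  qed
  then show "\<exists>e>0. \<forall>y. dist y x < e \<longrightarrow> y \<in> C_set g"
    using e by (intro exI[of _ "e / 2"]) auto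
qed

text \<open>Brings components into the form used by \<open>N_minus\<close>, \<open>N_plus\<close>
  and \<open>has_g_derivative\<close>.\<close>

lemma C_set_component_einterval:
  assumes "x \<in> C_set g"
  obtains a b where "einterval a b \<in> components (C_set g)" "x \<in> einterval a b"
proof -
  define K where "K = connected_component_set (C_set g) x"
  have "K \<in> components (C_set g)" "x \<in> K"
    using assms by (auto simp: K_def components_def connected_component_refl)
  moreover from this have "K = einterval (Inf (ereal ` K)) (Sup (ereal ` K))"
    by (intro open_connected_real_eq_einterval)
       (auto intro: open_components[OF open_C_set] in_components_connected)
  ultimately show ?thesis using that by metis
qed

lemma C_set_constant:
  assumes "p \<le> q" "{p..q} \<subseteq> C_set g"
  shows "g p = g q"
  using assms(1)
proof (induction rule: Bolzano)
  case (local z)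
  then have "z \<in> C_set g" using assms(2) by auto
  then obtain e c where e: "e > 0" and c: "\<And>y. y \<in> {z - e<..<z + e} \<Longrightarrow> g y = c"
    by (auto simp: C_set_def constant_on_def)
  have "g p = g q" if "p \<le> z" "z \<le> q" "q - p < e" for p q
    using c[of p] c[of q] that by auto
  then show ?case using e by blast
qed simp

section \<open>Strict growth of the derivator on the sides where limits are taken\<close>

context
  fixes g :: "real \<Rightarrow> real"
  assumes g: "derivator g"
begin

text \<open>Monotonicity squeezes \<open>g\<close> between two equal values. Read contrapositively,
  this yields the strict inequalities in the lemmas that follow.\<close>

lemma C_setI:
  assumes "p < x" "x < q" "g p = g q"
  shows "x \<in> C_set g"
proof -
  define e where "e = min (x - p) (q - x)"
  have "g y = g p" if "y \<in> {x - e<..<x + e}" for y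
    using derivator_mono[OF g, of p y] derivator_mono[OF g, of y q] assms that
    by (auto simp: e_def min_def split: if_splits)
  then have "g constant_on {x - e<..<x + e}" by (auto simp: constant_on_def)
  moreover have "e > 0" using assms by (auto simp: e_def)
  ultimately show ?thesis by (auto simp: C_set_def)
qed

text \<open>Left continuity extends the constant value to \<open>b\<close>. Maximality of the
  component keeps \<open>b\<close> out of \<open>C_set g\<close>, so \<open>g\<close> cannot stay at
  \<open>g b\<close> to the right of \<open>b\<close>; this makes the right quotient at
  \<open>b\<close> meaningful.\<close>

lemma component_upper_end:
  assumes comp: "einterval a (ereal b) \<in> components (C_set g)"
  shows "b \<notin> C_set g" and "x \<in> einterval a (ereal b) \<Longrightarrow> g x = g b"
    and "b < y \<Longrightarrow> g b < g y"
proof -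
  have const: "g x = g b" if x: "x \<in> einterval a (ereal b)" for x
  proof -
    have xb: "x < b" using x by (simp add: einterval_iff)
    have "\<forall>\<^sub>F y in at_left b. g y = g x"
      unfolding eventually_at_left_field
    proof (intro exI[of _ x] conjI allI impI xb)
      fix y assume y: "x < y" "y < b"
      have "{x..y} \<subseteq> einterval a (ereal b)"
        using x y by (intro einterval_interval) (auto simp: einterval_iff elim: less_trans)
      then show "g y = g x"
        using C_set_constant[of x y g] in_components_subset[OF comp] y by auto
    qed
    then have "(g \<longlongrightarrow> g x) (at_left b)"
      by (rule tendsto_eventually)
    then show ?thesis
      using derivator_tendsto_left[OF g, of b] tendsto_unique trivial_limit_at_left_real by blast
  qed
  then show "x \<in> einterval a (ereal b) \<Longrightarrow> g x = g b" .
  obtain x where x: "x \<in> einterval a (ereal b)"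
    using in_components_nonempty[OF comp] by blast
  then have xb: "x < b" by (simp add: einterval_iff)
  show b: "b \<notin> C_set g"
  proof
    assume "b \<in> C_set g"
    moreover have "y \<in> C_set g" if "x \<le> y" "y < b" for y
    proof -
      have "y \<in> einterval a (ereal b)"
        using x that by (auto simp: einterval_iff intro: less_le_trans)
      then show ?thesis using in_components_subset[OF comp] by auto
    qed
    ultimately have "{x..b} \<subseteq> C_set g" by (auto simp: le_less)
    then have "{x..b} \<subseteq> einterval a (ereal b)"
      using x xb by (intro components_maximal[OF comp]) auto
    then show False using xb by (auto simp: einterval_iff subset_eq)
  qed
  show "g b < g y" if "b < y"
    using C_setI[of x b y] b that xb const[OF x] derivator_mono[OF g, of b y] by force
qed

text \<open>At a lower end it is the vanishing jump that carries the value of the component to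
  \<open>a\<close>. Then \<open>g y = g a\<close> would place \<open>a\<close> inside an interval of
  constancy.\<close>

lemma component_lower_end:
  assumes comp: "einterval (ereal a) b \<in> components (C_set g)" and "jump g a = 0"
    and "a \<notin> C_set g" and "y < a"
  shows "g y < g a"
proof -
  obtain x where x: "x \<in> einterval (ereal a) b"
    using in_components_nonempty[OF comp] by blast
  then have ax: "a < x" by (simp add: einterval_iff)
  have "\<forall>\<^sub>F z in at_right a. g z = g x"
    unfolding eventually_at_right_field
  proof (intro exI[of _ x] conjI allI impI ax)
    fix z assume z: "a < z" "z < x"
    have "{z..x} \<subseteq> einterval (ereal a) b"
      using x z by (intro einterval_interval) (auto simp: einterval_iff elim: less_trans[rotated])
    then show "g z = g x"
      using C_set_constant[of z x g] in_components_subset[OF comp] z by auto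
  qed
  then have "(g \<longlongrightarrow> g x) (at_right a)"
    by (rule tendsto_eventually)
  then have "g x = g a"
    using derivator_tendsto_right[OF g, of a] \<open>jump g a = 0\<close>
      tendsto_unique trivial_limit_at_right_real by fastforce
  then show ?thesis
    using C_setI[of y a x] assms ax derivator_mono[OF g, of y a] by force
qed

text \<open>If \<open>g y = g x\<close>, then \<open>{y<..<x}\<close> lies in one component of
  \<open>C_set g\<close>. It reaches up to \<open>x\<close> but cannot contain it, so
  \<open>x\<close> is its upper end and belongs to \<open>N_plus g\<close>.\<close>

lemma less_left_if_not_N_plus:
  assumes "x \<notin> C_set g" "x \<notin> D_set g" "ereal x \<notin> N_plus g" "y < x"
  shows "g y < g x"
proof (rule ccontr)
  assume "\<not> g y < g x"
  then have eq: "g y = g x" using derivator_mono[OF g, of y x] assms(4) by simp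
  then have sub: "{y<..<x} \<subseteq> C_set g" using C_setI[of y _ x] by auto
  obtain m where m: "y < m" "m < x" using dense[OF assms(4)] by auto
  then have "m \<in> C_set g" using sub by auto
  then obtain a b where ab: "einterval a b \<in> components (C_set g)" "m \<in> einterval a b"
    by (rule C_set_component_einterval)
  have sup: "{y<..<x} \<subseteq> einterval a b"
    using m ab(2) sub by (intro components_maximal[OF ab(1)]) auto
  have "ereal x \<le> b"
  proof (rule dense_le_bounded[of "ereal m"])
    fix w assume "ereal m < w" "w < ereal x"
    then obtain r where "w = ereal r" "m < r" "r < x" by (cases w) auto
    then show "w \<le> b" using sup m by (auto simp: einterval_iff subset_eq less_imp_le)
  qed (use m in simp)
  moreover have "\<not> ereal x < b"
  proof
    assume "ereal x < b"
    then have "x \<in> einterval a b"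
      using ab(2) m less_trans[of a "ereal m" "ereal x"] by (simp add: einterval_iff)
    then show False using in_components_subset[OF ab(1)] assms(1) by auto
  qed
  ultimately have "b = ereal x" by simp
  then show False using assms(2,3) ab(1) by (auto simp: N_plus_def)
qed

text \<open>Mirror image of the previous argument, with the lower end of the component.\<close>

lemma less_right_if_not_N_minus:
  assumes "x \<notin> C_set g" "x \<notin> D_set g" "ereal x \<notin> N_minus g" "x < y"
  shows "g x < g y"
proof (rule ccontr)
  assume "\<not> g x < g y"
  then have eq: "g x = g y" using derivator_mono[OF g, of x y] assms(4) by simp
  then have sub: "{x<..<y} \<subseteq> C_set g" using C_setI[of x _ y] by auto
  obtain m where m: "x < m" "m < y" using dense[OF assms(4)] by auto
  then have "m \<in> C_set g" using sub by auto
  then obtain a b where ab: "einterval a b \<in> components (C_set g)" "m \<in> einterval a b"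
    by (rule C_set_component_einterval)
  have sup: "{x<..<y} \<subseteq> einterval a b"
    using m ab(2) sub by (intro components_maximal[OF ab(1)]) auto
  have "a \<le> ereal x"
  proof (rule dense_ge_bounded[of _ "ereal m"])
    fix w assume "ereal x < w" "w < ereal m"
    then obtain r where "w = ereal r" "x < r" "r < m" by (cases w) auto
    then show "a \<le> w" using sup m by (auto simp: einterval_iff subset_eq less_imp_le)
  qed (use m in simp)
  moreover have "\<not> a < ereal x"
  proof
    assume "a < ereal x"
    then have "x \<in> einterval a b"
      using ab(2) m less_trans[of "ereal x" "ereal m" b] by (simp add: einterval_iff)
    then show False using in_components_subset[OF ab(1)] assms(1) by auto
  qed
  ultimately have "a = ereal x" by simp
  then show False using assms(2,3) ab(1) by (auto simp: N_minus_def)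
qed

end

theorem corollary5p12:
  fixes g :: "real \<Rightarrow> real"
    and l :: "'a::{real_normed_field,banach}"
    and x0 :: real
  assumes "derivator g"
    and "\<infinity> \<notin> N_plus g"
    and "l \<noteq> 0"
    and "\<And>x. x < x0 \<Longrightarrow> 1 + l * of_real (jump g x) \<noteq> 0"
  shows "stieltjes_analytic_on g (Exp_g g l x0) UNIV \<and>
    (\<forall>x. has_g_derivative g (Exp_g g l x0) (l * Exp_g g l x0 x) x) \<and>
    Exp_g g l x0 x0 = 1"
proof (intro conjI allI)
  note g = assms(1) and nz = assms(4)
  show "stieltjes_analytic_on g (Exp_g g l x0) UNIV"
    using g nz by (rule Exp_g_analytic)
  show "Exp_g g l x0 x0 = 1"
    using g nz by (rule Exp_g_self)
  fix x
  let ?v = "Exp_g g l x0"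
  let ?q = "\<lambda>z y. (?v y - ?v z) / of_real (g y - g z)"
  have right: "(?q z \<longlongrightarrow> l * ?v z) (at_right z)" if "\<And>y. z < y \<Longrightarrow> g z < g y" for z
    using g nz that by (rule Exp_g_quotient_right)
  have left: "(?q z \<longlongrightarrow> l * ?v z) (at_left z)" if "\<And>y. y < z \<Longrightarrow> g y < g z" for z
    using g nz that by (rule Exp_g_quotient_left)
  \<comment> \<open>The cases follow the nested conditionals of \<open>has_g_derivative\<close> in
    their order.\<close>
  consider (D) "x \<in> D_set g" | (C) "x \<notin> D_set g" "x \<in> C_set g"
    | (Np) "x \<notin> D_set g" "x \<notin> C_set g" "ereal x \<in> N_plus g"
    | (Nm) "x \<notin> D_set g" "x \<notin> C_set g" "ereal x \<notin> N_plus g" "ereal x \<in> N_minus g"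
    | (reg) "x \<notin> D_set g" "x \<notin> C_set g" "ereal x \<notin> N_plus g" "ereal x \<notin> N_minus g"
    by blast
  then show "has_g_derivative g ?v (l * ?v x) x"
  proof cases
    case D
    have "g x < g y" if "x < y" for y
      using jump_le[OF g that] D by (simp add: D_set_def)
    then have "(?q x \<longlongrightarrow> l * ?v x) (at_right x)" by (rule right)
    then show ?thesis using D by (simp add: has_g_derivative_def)
  next
    case C
    then obtain a b where ab: "einterval a b \<in> components (C_set g)" "x \<in> einterval a b"
      using C_set_component_einterval by blast
    \<comment> \<open>An infinite upper end survives the removal of the real points of
      \<open>D_set g\<close>, so it would belong to \<open>N_plus g\<close>.\<close>
    have "b \<noteq> \<infinity>" using ab(1) assms(2) by (auto simp: N_plus_def)
    moreover have "b \<noteq> -\<infinity>" using ab(2) by (auto simp: einterval_iff)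
    ultimately obtain r where r: "b = ereal r" by (cases b) auto
    note comp = ab[unfolded r]
    note upper = component_upper_end[OF g comp(1)]
    have "x \<le> r" using comp(2) by (simp add: einterval_iff)
    \<comment> \<open>The limit at \<open>r\<close> has value \<open>l * ?v r\<close>, whereas the
      equation at \<open>x\<close> demands \<open>l * ?v x\<close>; constancy of \<open>g\<close>
      from \<open>x\<close> to \<open>r\<close> identifies the two.\<close>
    with g nz have "?v r = ?v x * exp_series g l x r"
      by (rule Exp_g_mult)
    also have "\<dots> = ?v x"
      using exp_series_eq_1[OF g \<open>x \<le> r\<close> upper(2)[OF comp(2)], of l] by simp
    finally have eq: "?v r = ?v x" .
    have "(?q r \<longlongrightarrow> l * ?v r) (at_right r)" by (rule right[OF upper(3)])
    then have "(?q r \<longlongrightarrow> l * ?v x) (at_right r)" by (simp only: eq)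
    then show ?thesis
      using C comp unfolding has_g_derivative_def Let_def by auto
  next
    case Np
    then obtain a where "einterval a (ereal x) \<in> components (C_set g)"
      by (auto simp: N_plus_def)
    then have "(?q x \<longlongrightarrow> l * ?v x) (at_right x)"
      by (intro right component_upper_end(3)[OF g])
    then show ?thesis using Np by (simp add: has_g_derivative_def)
  next
    case Nm
    then obtain b where "einterval (ereal x) b \<in> components (C_set g)"
      by (auto simp: N_minus_def)
    moreover have "jump g x = 0"
      using Nm jump_nonneg[OF g, of x] by (simp add: D_set_def)
    ultimately have "(?q x \<longlongrightarrow> l * ?v x) (at_left x)"
      using Nm by (intro left component_lower_end[OF g])
    then show ?thesis using Nm by (simp add: has_g_derivative_def)
  next
    case reg
    have "(?q x \<longlongrightarrow> l * ?v x) (at_left x)"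
      using reg by (intro left less_left_if_not_N_plus[OF g])
    moreover have "(?q x \<longlongrightarrow> l * ?v x) (at_right x)"
      using reg by (intro right less_right_if_not_N_minus[OF g])
    ultimately have "(?q x \<longlongrightarrow> l * ?v x) (at x)" by (rule filterlim_split_at)
    then show ?thesis using reg by (simp add: has_g_derivative_def)
  qed
qed

end
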